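(* Let $p\geq 5$ be a prime and $$c_p(T)=T+(T^3-T)^p\in\mathbf{F}_p[T].$$ Then $c_p$ is nonexceptional. Moreover, it induces the function $T\mapsto T^3$ on $\mathbf{F}_p$; hence it is a mock automorphism over $\mathbf{F}_p$ precisely when $p\equiv 2\pmod 3$.
   Context: A polynomial $f\in\mathbf{F}_p[T]$ is a (one-variable) mock automorphism over $\mathbf{F}_p$ if its derivative $f'$ is a nonzero constant and $f$ induces a bijection $\mathbf{F}_p\to\mathbf{F}_p$. It is exceptional if $f$ induces a bijection $\mathbf{F}_{p^m}\to\mathbf{F}_{p^m}$ for infinitely many $m\ge1$, and nonexceptional otherwise. *)

theory Defs
  imports "HOL-Algebra.Algebraic_Closure_Type" "HOL-Number_Theory.Residues"
    "HOL-Library.Cardinality"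
begin

text \<open>
  The base field is a type \<open>'a :: finite_field\<close>; the prime field with \<open>p\<close> elements is any such type
  with \<open>CARD('a) = p\<close> prime (such as the integers modulo \<open>p\<close>). Its extension of degree \<open>m \<ge> 1\<close> is realised
  inside the algebraic closure as the set of roots of \<open>X ^ (CARD('a) ^ m) - X\<close>. For prime
  \<open>CARD('a)\<close>, the lemmas below confirm that this is a field containing the base field, that it has
  \<open>CARD('a) ^ m\<close> elements, and that it is the only subfield of that size.
\<close>

definition finite_ext :: "nat \<Rightarrow> 'a::finite_field alg_closure set" where
  "finite_ext m = {x. x ^ (CARD('a) ^ m) = x}"

definition mock_automorphism :: "'a::finite_field poly \<Rightarrow> bool" where
  "mock_automorphism f \<longleftrightarrow> (\<exists>a. a \<noteq> 0 \<and> pderiv f = [:a:]) \<and> bij (poly f)"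

definition exceptional :: "'a::finite_field poly \<Rightarrow> bool" where
  "exceptional f \<longleftrightarrow>
     infinite {m. m \<ge> 1 \<and> bij_betw (poly (map_poly to_ac f)) (finite_ext m) (finite_ext m)}"

definition c_poly :: "nat \<Rightarrow> 'a::comm_ring_1 poly" where
  "c_poly p = [:0, 1:] + ([:0, 1:] ^ 3 - [:0, 1:]) ^ p"

lemma to_ac_in_finite_ext: "to_ac (x :: 'a::finite_field) \<in> finite_ext m"
  using finite_field_power_card_power_eq_same[of "CARD('a) ^ m" m x]
  by (simp add: finite_ext_def flip: to_ac_power)

lemma CHAR_eq_CARD_prime:
  assumes "Factorial_Ring.prime CARD('a::finite_field)"
  shows "CHAR('a) = CARD('a)"
  using assms CHAR_dvd_CARD[where 'a = 'a] CHAR_prime[where 'a = 'a]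
  by (metis primes_dvd_imp_eq)

lemma finite_ext_one: "1 \<in> finite_ext m"
  by (simp add: finite_ext_def)

lemma finite_ext_mult:
  "x \<in> finite_ext m \<Longrightarrow> y \<in> finite_ext m \<Longrightarrow> x * y \<in> finite_ext m"
  by (simp add: finite_ext_def power_mult_distrib)

lemma finite_ext_inverse: "x \<in> finite_ext m \<Longrightarrow> inverse x \<in> finite_ext m"
  by (simp add: finite_ext_def power_inverse)

lemma finite_ext_add:
  fixes x y :: "'a::finite_field alg_closure"
  assumes "Factorial_Ring.prime CARD('a)" "x \<in> finite_ext m" "y \<in> finite_ext m"
  shows "x + y \<in> finite_ext m"
proof -
  have "(x + y) ^ (CARD('a) ^ m) = x ^ (CARD('a) ^ m) + y ^ (CARD('a) ^ m)"
    by (rule freshmans_dream'[where n = m]) (simp_all add: CHAR_eq_CARD_prime assms(1))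
  with assms show ?thesis by (simp add: finite_ext_def)
qed

lemma finite_ext_minus:
  fixes x :: "'a::finite_field alg_closure"
  assumes "Factorial_Ring.prime CARD('a)" "x \<in> finite_ext m"
  shows "- x \<in> finite_ext m"
  using finite_ext_mult[OF _ assms(2), of "-1"] to_ac_in_finite_ext[of "-1 :: 'a" m] by simp

lemma card_finite_ext:
  assumes "Factorial_Ring.prime CARD('a::finite_field)" "m \<ge> 1"
  shows "card (finite_ext m :: 'a alg_closure set) = CARD('a) ^ m"
proof -
  define q where "q = CARD('a) ^ m"
  define P :: "'a alg_closure poly" where "P = monom 1 q - monom 1 1"
  have q: "q > 1"
    unfolding q_def using assms(2) by (intro one_less_power prime_gt_1_nat assms(1)) simp
  have "Polynomial.degree (monom (1::'a alg_closure) q - monom 1 1) = q"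
    unfolding diff_conv_add_uminus
    by (subst degree_add_eq_left) (use q in \<open>simp_all add: degree_monom_eq\<close>)
  hence deg: "Polynomial.degree P = q" by (simp add: P_def)
  hence "P \<noteq> 0" using q by auto
  have poly_P: "poly P x = x ^ q - x" for x
    by (simp add: P_def poly_monom)
  have "(of_nat CARD('a) :: 'a alg_closure) = 0"
    by (metis CHAR_alg_closure CHAR_eq_CARD_prime assms(1) of_nat_CHAR)
  hence q0: "(of_nat q :: 'a alg_closure) = 0"
    using assms(2) by (simp add: q_def)
  have deriv: "pderiv P = [:-1:]"
    by (simp add: P_def pderiv_diff pderiv_monom q0 monom_0 one_pCons)
  obtain A where A: "size A = Polynomial.degree P"
    "P = Polynomial.smult (Polynomial.lead_coeff P) (\<Prod>x\<in>#A. [:-x, 1:])"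
    using alg_closed_imp_factorization[OF \<open>P \<noteq> 0\<close>] by metis
  have "count A x \<le> 1" for x
  proof (rule ccontr)
    assume "\<not> count A x \<le> 1"
    hence "{#x, x#} \<subseteq># A"
      by (intro mset_subset_eqI) auto
    then obtain B where "A = {#x, x#} + B" by (metis subset_mset.le_iff_add)
    hence "(\<Prod>x\<in>#A. [:-x, 1:]) = [:-x, 1:] * ([:-x, 1:] * (\<Prod>x\<in>#B. [:-x, 1:]))"
      by simp
    then obtain Q where "P = [:-x, 1:] * ([:-x, 1:] * Q)"
      using A(2) by (metis mult_smult_right)
    hence "poly (pderiv P) x = 0"
      by (simp only: pderiv_mult) simp
    thus False by (simp add: deriv)
  qed
  hence "A = mset_set (set_mset A)"
    by (intro multiset_eqI) (metis count_mset_set(1,3) finite_set_mset le_neq_implies_less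
      less_one not_in_iff)
  hence "card (set_mset A) = q"
    using A(1) deg by (metis size_mset_set)
  moreover have "finite_ext m = set_mset A"
  proof -
    have "x \<in> finite_ext m \<longleftrightarrow> poly P x = 0" for x
      by (simp add: finite_ext_def poly_P q_def)
    moreover have "poly P x = 0 \<longleftrightarrow> x \<in># A" for x
      by (subst A(2)) (use \<open>P \<noteq> 0\<close> in \<open>auto simp: poly_prod_mset\<close>)
    ultimately show ?thesis by blast
  qed
  ultimately show ?thesis by (simp add: q_def)
qed

lemma finite_ext_unique:
  fixes K :: "'a::finite_field alg_closure set"
  assumes K0: "0 \<in> K" and Kmult: "\<And>x y. x \<in> K \<Longrightarrow> y \<in> K \<Longrightarrow> x * y \<in> K"
    and card: "card K = CARD('a) ^ m"
    and "Factorial_Ring.prime CARD('a)" "m \<ge> 1"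
  shows "K = finite_ext m"
proof -
  have pos: "CARD('a) ^ m > 0" by simp
  have fin: "finite K" using card pos card_ge_0_finite by metis
  have "x ^ card K = x" if "x \<in> K" "x \<noteq> 0" for x
  proof -
    have inj: "inj_on ((*) x) (K - {0})" using that by (auto simp: inj_on_def)
    have "(*) x ` (K - {0}) = K - {0}"
      by (rule card_subset_eq) (use fin that Kmult inj in \<open>auto simp: card_image\<close>)
    hence "\<Prod>(K - {0}) = (\<Prod>y\<in>K - {0}. x * y)"
      using prod.reindex[OF inj, of id] by (simp add: o_def)
    also have "\<dots> = x ^ (card K - 1) * \<Prod>(K - {0})"
      using fin K0 by (simp add: prod.distrib)
    finally have "x ^ (card K - 1) = 1" using fin by simp
    thus ?thesis using card pos by (metis Suc_pred' mult.right_neutral power_Suc)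
  qed
  moreover have "0 ^ card K = (0 :: 'a alg_closure)" using pos card by simp
  ultimately have "x ^ card K = x" if "x \<in> K" for x using that by metis
  hence "K \<subseteq> finite_ext m" by (auto simp: finite_ext_def card)
  moreover have "finite (finite_ext m :: 'a alg_closure set)"
    using card_finite_ext[OF assms(4,5)] pos card_ge_0_finite by metis
  ultimately show ?thesis
    using card card_finite_ext[OF assms(4,5)] by (metis card_subset_eq)
qed

end

theory Submission
  imports Defs
begin

text \<open>
  Writing two arguments as \<open>u \<plusminus> e\<^sup>p/2\<close>, a collision of \<open>c\<^sub>p\<close> with \<open>e \<noteq> 0\<close> becomes \<open>-3 w\<^sup>2 = G(e)\<close>, where
  \<open>G = T\<^bsup>3p-1\<^esup> - 4 T\<^bsup>p-1\<^esup> + 4\<close> and \<open>w = 2 u e\<^bsup>(p-1)/2\<^esup>\<close>. If \<open>-3\<close> is a square in \<open>F\<^sub>q\<close>, \<open>q = p\<^sup>m\<close>,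
  then \<open>e = 1\<close> works, because \<open>G(1) = 1\<close>. Otherwise any \<open>e \<in> F\<^sub>q\<close> for which \<open>G(e)\<close> is not a nonzero square
  works; here \<open>e \<noteq> 0\<close> because \<open>G(0) = 4\<close> is a nonzero square.

  Such an \<open>e\<close> exists for \<open>m \<ge> 6\<close> by the method of Stepanov and Bombieri. Put \<open>P = p\<^sup>2\<close>, \<open>Q = q/P\<close>,
  and suppose that all values of \<open>G\<close> on \<open>F\<^sub>q\<close> are nonzero squares. Linear algebra gives polynomials
  \<open>u\<^sub>j, w\<^sub>j\<close> of degree below \<open>Q/2\<close>, not all zero, with
  \<open>\<Sum>\<^sub>j T\<^sup>j (u\<^sub>j\<^sup>P + w\<^sub>j\<^sup>P G\<^bsup>(P+1)/2\<^esup>) = 0\<close>. Then \<open>h = \<Sum>\<^sub>j T\<^bsup>jQ\<^esup> (u\<^sub>j + w\<^sub>j G\<^bsup>(Q+1)/2\<^esup>)\<close> vanishes on \<open>F\<^sub>q\<close>,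
  since on \<open>F\<^sub>q\<close> the power \<open>h\<^sup>P\<close> agrees with the previous sum. But \<open>deg h < q\<close>, and \<open>h \<noteq> 0\<close> because
  \<open>G\<close> has a simple root.
\<close>

section \<open>Linear dependence of polynomials of bounded degree\<close>

text \<open>The polynomials lie in a space of dimension \<open>n\<close>, and \<open>I\<close> has
  more than \<open>n\<close> indices. The induction is Gaussian elimination on the top
  coefficient.\<close>

lemma exists_linear_relation:
  fixes b :: "'i \<Rightarrow> 'k::field poly"
  assumes "finite I" "n < card I" "\<And>i. i \<in> I \<Longrightarrow> Polynomial.degree (b i) < n"
  shows "\<exists>c. (\<exists>i\<in>I. c i \<noteq> 0) \<and> (\<Sum>i\<in>I. Polynomial.smult (c i) (b i)) = 0"
proof -
  \<comment> \<open>The induction uses vanishing of the coefficients from \<open>n\<close> on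
    instead of the degree: the zero polynomial has degree 0, so a degree bound could not reach
    \<open>n = 0\<close>.\<close>
  have "\<And>i k. i \<in> I \<Longrightarrow> n \<le> k \<Longrightarrow> poly.coeff (b i) k = 0"
    using assms(3) by (meson coeff_eq_0 order_less_le_trans)
  with assms(1,2) show ?thesis
  proof (induction n arbitrary: I b)
    case 0
    then have "I \<noteq> {}" "\<And>i. i \<in> I \<Longrightarrow> b i = 0" by (auto simp: poly_eq_iff)
    then show ?case by (intro exI[of _ "\<lambda>_. 1"]) auto
  next
    case (Suc n)
    show ?case
    proof (cases "\<forall>i\<in>I. poly.coeff (b i) n = 0")
      case True
      show ?thesis
      proof (rule Suc.IH)
        fix i k assume "i \<in> I" "n \<le> k"
        then show "poly.coeff (b i) k = 0"
          using Suc.prems(3)[of i k] True by (cases "k = n") auto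
      qed (use Suc.prems in auto)
    next
      case False
      then obtain i0 where i0: "i0 \<in> I" "poly.coeff (b i0) n \<noteq> 0" by blast
      \<comment> \<open>The pivot \<open>b i0\<close> clears the coefficient at \<open>n\<close> in
        all the other polynomials, which uses up one index and one dimension.\<close>
      define t where "t i = poly.coeff (b i) n / poly.coeff (b i0) n" for i
      have "\<exists>c. (\<exists>i\<in>I - {i0}. c i \<noteq> 0) \<and>
        (\<Sum>i\<in>I - {i0}. Polynomial.smult (c i) (b i - Polynomial.smult (t i) (b i0))) = 0"
      proof (rule Suc.IH)
        fix i k assume "i \<in> I - {i0}" "n \<le> k"
        then show "poly.coeff (b i - Polynomial.smult (t i) (b i0)) k = 0"
          using Suc.prems(3)[of i k] Suc.prems(3)[of i0 k] i0 by (cases "k = n") (auto simp: t_def)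
      qed (use Suc.prems i0 in auto)
      then obtain c where c: "\<exists>i\<in>I - {i0}. c i \<noteq> 0"
        "(\<Sum>i\<in>I - {i0}. Polynomial.smult (c i) (b i - Polynomial.smult (t i) (b i0))) = 0" by blast
      \<comment> \<open>The value at \<open>i0\<close> collects the multiples of the pivot that were
        subtracted during elimination.\<close>
      define c' where "c' = c(i0 := - (\<Sum>i\<in>I - {i0}. c i * t i))"
      have "(\<Sum>i\<in>I. Polynomial.smult (c' i) (b i)) =
          Polynomial.smult (c' i0) (b i0) + (\<Sum>i\<in>I - {i0}. Polynomial.smult (c' i) (b i))"
        using i0 Suc.prems(1) by (simp add: sum.remove)
      also have "(\<Sum>i\<in>I - {i0}. Polynomial.smult (c' i) (b i)) =
          (\<Sum>i\<in>I - {i0}. Polynomial.smult (c i) (b i))"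
        by (rule sum.cong) (auto simp: c'_def)
      also have "Polynomial.smult (c' i0) (b i0) =
          - (\<Sum>i\<in>I - {i0}. Polynomial.smult (c i * t i) (b i0))"
        by (simp add: c'_def smult_sum)
      also have "- (\<Sum>i\<in>I - {i0}. Polynomial.smult (c i * t i) (b i0)) +
          (\<Sum>i\<in>I - {i0}. Polynomial.smult (c i) (b i)) = 0"
        using c(2) by (simp add: smult_diff_right sum_subtractf)
      finally have "(\<Sum>i\<in>I. Polynomial.smult (c' i) (b i)) = 0" .
      moreover have "\<exists>i\<in>I. c' i \<noteq> 0" using c(1) by (auto simp: c'_def)
      ultimately show ?thesis by blast
    qed
  qed
qed

section \<open>Nonvanishing of the auxiliary polynomial\<close>

text \<open>Parity of orders at \<open>r\<close>: for nonzero \<open>u\<close> and \<open>w\<close>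
  the left side has even order, the right side odd order.\<close>

lemma square_eq_smult_square_times_imp_0:
  fixes u w G :: "'k::idom poly"
  assumes "odd (Polynomial.order r G)" "G \<noteq> 0" "a \<noteq> 0" "u\<^sup>2 = Polynomial.smult a (w\<^sup>2 * G)"
  shows "u = 0 \<and> w = 0"
proof (cases "w = 0")
  case False
  have "u \<noteq> 0" using assms False by auto
  then have "2 * Polynomial.order r u = 2 * Polynomial.order r w + Polynomial.order r G"
    using arg_cong[OF assms(4), of "Polynomial.order r"] assms(2,3) False
    by (simp add: order_smult order_mult power2_eq_square)
  then show ?thesis using assms(1) by presburger
qed (use assms in auto)

text \<open>Multiplying by the conjugate \<open>u - w * G ^ ((Q + 1) div 2)\<close> removes the half
  power, since its square is \<open>G * G ^ Q\<close>. By Frobenius, \<open>G ^ Q\<close> is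
  congruent to the constant \<open>a ^ Q\<close> modulo \<open>T^Q\<close>, where
  \<open>a = G(0)\<close>. So \<open>T^Q\<close> divides \<open>u^2 - a^Q w^2 G\<close>, whose
  degree is below \<open>Q\<close>; it is therefore zero, and the parity of orders applies.\<close>

lemma stepanov_nonvanishing_step:
  fixes u w G :: "'k::field poly"
  assumes "Factorial_Ring.prime CHAR('k)" and Q: "Q = CHAR('k) ^ l" "odd Q"
    and G: "odd (Polynomial.order r G)" "poly G 0 \<noteq> 0"
    and deg: "2 * Polynomial.degree u < Q" "2 * Polynomial.degree w + Polynomial.degree G < Q"
    and dvd: "monom 1 Q dvd u + w * G ^ ((Q + 1) div 2)"
  shows "u = 0 \<and> w = 0"
proof -
  define a where "a = poly G 0"
  have K: "(G ^ ((Q + 1) div 2))\<^sup>2 = G * G ^ Q"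
  proof -
    have "(Q + 1) div 2 * 2 = Suc Q" using Q(2) by presburger
    then show ?thesis by (simp only: power_Suc flip: power_mult)
  qed
  have "monom 1 1 dvd G - [:a:]"
    using poly_eq_0_iff_dvd[of "G - [:a:]" 0] by (simp add: a_def monom_altdef)
  then have mdvd: "monom 1 1 ^ Q dvd (G - [:a:]) ^ Q" by (rule dvd_power_same)
  have "(G - [:a:] + [:a:]) ^ Q = (G - [:a:]) ^ Q + [:a:] ^ Q"
    by (rule freshmans_dream'[where n = l]) (use assms in simp_all)
  then have "(G - [:a:]) ^ Q = G ^ Q - [:a ^ Q:]" by (simp add: poly_const_pow)
  with mdvd have GQ: "monom 1 Q dvd G ^ Q - [:a ^ Q:]"
    by (simp add: monom_power)
  have "monom 1 Q dvd (u + w * G ^ ((Q + 1) div 2)) * (u - w * G ^ ((Q + 1) div 2))"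
    using dvd by simp
  also have "\<dots> = u\<^sup>2 - w\<^sup>2 * (G ^ ((Q + 1) div 2))\<^sup>2" by (simp add: algebra_simps power2_eq_square)
  also have "\<dots> = (u\<^sup>2 - Polynomial.smult (a ^ Q) (w\<^sup>2 * G)) - w\<^sup>2 * G * (G ^ Q - [:a ^ Q:])"
    unfolding K by (simp add: algebra_simps)
  finally have "monom 1 Q dvd u\<^sup>2 - Polynomial.smult (a ^ Q) (w\<^sup>2 * G)"
    using dvd_add[OF _ dvd_mult[OF GQ, of "w\<^sup>2 * G"]] by fastforce
  moreover have "Polynomial.degree (u\<^sup>2 - Polynomial.smult (a ^ Q) (w\<^sup>2 * G)) < Q"
  proof (rule degree_diff_less)
    show "Polynomial.degree (u\<^sup>2) < Q" using deg(1) degree_power_le[of u 2] by linarith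
    have "Polynomial.degree (w\<^sup>2 * G) \<le> Polynomial.degree w * 2 + Polynomial.degree G"
      using degree_mult_le[of "w\<^sup>2" G] degree_power_le[of w 2] by linarith
    then show "Polynomial.degree (Polynomial.smult (a ^ Q) (w\<^sup>2 * G)) < Q"
      using deg(2) degree_smult_le[of "a ^ Q" "w\<^sup>2 * G"] by linarith
  qed
  ultimately have "u\<^sup>2 - Polynomial.smult (a ^ Q) (w\<^sup>2 * G) = 0"
    using dvd_imp_degree_le[of "monom 1 Q"] degree_monom_eq[of "1::'k" Q]
    by (metis not_le zero_neq_one)
  moreover have "G \<noteq> 0" "a ^ Q \<noteq> 0" using G(2) by (auto simp: a_def)
  ultimately show ?thesis
    using square_eq_smult_square_times_imp_0[OF G(1)] by (metis eq_iff_diff_eq_0)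
qed

text \<open>All terms with \<open>j > 0\<close> are divisible by \<open>T^Q\<close>, so the
  single-term case kills \<open>u 0\<close> and \<open>w 0\<close>. Cancelling \<open>T^Q\<close>
  leaves a sum of the same shape with shifted coefficients.\<close>

lemma stepanov_nonvanishing:
  fixes G :: "'k::field poly" and u w :: "nat \<Rightarrow> 'k poly"
  assumes "Factorial_Ring.prime CHAR('k)" "Q = CHAR('k) ^ l" "odd Q"
    and "odd (Polynomial.order r G)" "poly G 0 \<noteq> 0"
    and deg: "\<And>j. 2 * Polynomial.degree (u j) < Q"
      "\<And>j. 2 * Polynomial.degree (w j) + Polynomial.degree G < Q"
    and "(\<Sum>j<J. monom 1 (j * Q) * (u j + w j * G ^ ((Q + 1) div 2))) = 0"
    and "j < J"
  shows "u j = 0 \<and> w j = 0"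
  using deg assms(8,9)
proof (induction J arbitrary: u w j)
  case (Suc J)
  define R where "R = (\<Sum>j<J. monom 1 (j * Q) * (u (Suc j) + w (Suc j) * G ^ ((Q + 1) div 2)))"
  have "(\<Sum>j<Suc J. monom 1 (j * Q) * (u j + w j * G ^ ((Q + 1) div 2))) =
      u 0 + w 0 * G ^ ((Q + 1) div 2) + monom 1 Q * R"
    by (simp add: sum.lessThan_Suc_shift R_def sum_distrib_left mult_monom
        del: sum.lessThan_Suc flip: mult.assoc)
  with Suc.prems(3) have eq: "u 0 + w 0 * G ^ ((Q + 1) div 2) + monom 1 Q * R = 0" by simp
  then have "u 0 + w 0 * G ^ ((Q + 1) div 2) = monom 1 Q * (- R)"
    by (simp add: eq_neg_iff_add_eq_0)
  then have "monom 1 Q dvd u 0 + w 0 * G ^ ((Q + 1) div 2)" by (metis dvd_triv_left)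
  then have 0: "u 0 = 0 \<and> w 0 = 0"
    by (intro stepanov_nonvanishing_step[OF assms(1-5)] Suc.prems(1,2))
  with eq have "R = 0" by (simp add: monom_eq_0_iff)
  then have "u (Suc i) = 0 \<and> w (Suc i) = 0" if "i < J" for i
    using Suc.IH[of "u \<circ> Suc" "w \<circ> Suc" i] Suc.prems(1,2) that by (simp add: R_def)
  with 0 Suc.prems(4) show ?case by (cases j) auto
qed simp

section \<open>Construction of the auxiliary polynomial\<close>

text \<open>The relation is linear in the \<open>P\<close>-th powers of the coefficients of
  \<open>u j\<close> and \<open>w j\<close>, so counting dimensions yields those powers, and roots
  exist in the algebraically closed field. The unknowns number \<open>J * A + J * (A - d)\<close>,
  and all polynomials involved have degree below \<open>J + (A - 1) * P + d\<close>. The choice of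
  \<open>A\<close> makes the first number exceed the second by \<open>P + 1\<close>.\<close>

lemma stepanov_auxiliary:
  fixes G :: "'k::alg_closed_field poly"
  assumes char: "Factorial_Ring.prime CHAR('k)" and P: "P = CHAR('k) ^ n" "odd P"
    and deg: "Polynomial.degree G = 2 * d"
    and J: "J = (P + 1) div 2" and A: "A = (J + 1) * (d + 1)"
  shows "\<exists>u w :: nat \<Rightarrow> 'k poly. (\<exists>j<J. u j \<noteq> 0 \<or> w j \<noteq> 0) \<and>
    (\<forall>j. Polynomial.degree (u j) < A) \<and> (\<forall>j. Polynomial.degree (w j) + d < A) \<and>
    (\<Sum>j<J. monom 1 j * (u j ^ P + w j ^ P * G ^ ((P + 1) div 2))) = 0"
proof -
  \<comment> \<open>The \<open>w j\<close> get \<open>d\<close> fewer coefficients to compensate for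
    the degree of \<open>H\<close>, which is at most \<open>d * P + d\<close>.\<close>
  define B where "B = A - d"
  define I where "I = ({..<J} \<times> {..<A}) <+> ({..<J} \<times> {..<B})"
  define H where "H = G ^ J"
  define f :: "nat \<Rightarrow> nat \<Rightarrow> 'k poly" where "f j k = monom 1 (j + k * P)" for j k
  define b where "b = case_sum (case_prod f) (\<lambda>(j, k). f j k * H)"
  define E where "E = J + (A - 1) * P + d"
  have P0: "P > 0" using P(2) by (rule odd_pos)
  have J2: "2 * J = P + 1" using P(2) J by presburger
  have AB: "A = B + d" "B > 0" unfolding B_def A by auto
  have degf: "Polynomial.degree (f j k) = j + k * P" for j k
    unfolding f_def by (simp add: degree_monom_eq)
  have degH: "Polynomial.degree H \<le> d * P + d"
  proof -
    have "Polynomial.degree H \<le> 2 * d * J" unfolding H_def deg[symmetric] by (rule degree_power_le)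
    also have "\<dots> = d * (2 * J)" by simp
    finally show ?thesis by (simp add: J2)
  qed
  have "E < card I"
  proof -
    have "card I = J * A + J * B" unfolding I_def by (simp add: card_Plus)
    then have "card I + J * d = 2 * J * A" by (simp add: AB algebra_simps)
    moreover have "2 * J * A = P * A + A" by (simp add: J2)
    moreover have "A = J * d + J + d + 1" by (simp add: A algebra_simps)
    moreover have "(A - 1) * P + P = P * A"
      using AB(2) unfolding AB(1) by (cases B) (auto simp: algebra_simps)
    ultimately show ?thesis using P0 unfolding E_def by linarith
  qed
  moreover have "Polynomial.degree (b i) < E" if "i \<in> I" for i
  proof -
    have f_less: "Polynomial.degree (f j k) < J + (C - 1) * P" if "j < J" "k < C" for j k C
    proof -
      have "k * P \<le> (C - 1) * P" using that by (intro mult_right_mono) auto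
      then show ?thesis using that(1) unfolding degf by (rule add_less_le_mono[rotated])
    qed
    from that consider j k where "i = Inl (j, k)" "j < J" "k < A"
      | j k where "i = Inr (j, k)" "j < J" "k < B" unfolding I_def by auto
    then show ?thesis
    proof cases
      case 1
      then show ?thesis using f_less[of j k A] by (simp add: b_def E_def)
    next
      case 2
      have "Polynomial.degree (f j k * H) < J + (B - 1) * P + (d * P + d)"
        using degree_mult_le[of "f j k" H] f_less[of j k B] degH 2 by linarith
      also have "\<dots> = E" using AB by (cases B) (auto simp: E_def algebra_simps)
      finally show ?thesis using 2 by (simp add: b_def)
    qed
  qed
  moreover have "finite I" by (simp add: I_def)
  ultimately obtain c where c: "\<exists>i\<in>I. c i \<noteq> 0" "(\<Sum>i\<in>I. Polynomial.smult (c i) (b i)) = 0"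
    using exists_linear_relation[of I E b] by blast
  \<comment> \<open>A choice of \<open>P\<close>-th roots turns the solution \<open>c\<close> into
    actual coefficients; by additivity of Frobenius, the \<open>P\<close>-th power of the resulting
    polynomial has the entries of \<open>c\<close> as coefficients.\<close>
  obtain \<rho> :: "'k \<Rightarrow> 'k" where \<rho>: "\<And>x. \<rho> x ^ P = x"
    using nth_root_exists[OF P0] by metis
  define u where "u j = (\<Sum>k<A. monom (\<rho> (c (Inl (j, k)))) k)" for j
  define w where "w j = (\<Sum>k<B. monom (\<rho> (c (Inr (j, k)))) k)" for j
  have coeffs: "poly.coeff (u j) k = \<rho> (c (Inl (j, k)))" if "k < A" for j k
    using that by (simp add: u_def coeff_sum)
  have coeffs': "poly.coeff (w j) k = \<rho> (c (Inr (j, k)))" if "k < B" for j k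
    using that by (simp add: w_def coeff_sum)
  have \<rho>0: "\<rho> x \<noteq> 0" if "x \<noteq> 0" for x
    using \<rho>[of x] that P0 by (auto simp: power_0_left)
  have power_P: "(\<Sum>k<C. monom (\<rho> (g k)) k) ^ P = (\<Sum>k<C. monom (g k) (k * P))" for C and g :: "nat \<Rightarrow> 'k"
    by (subst freshmans_dream_sum'[where n = n]) (use char P \<rho> in \<open>simp_all add: monom_power\<close>)
  have "0 = (\<Sum>(j,k)\<in>{..<J}\<times>{..<A}. Polynomial.smult (c (Inl (j, k))) (f j k)) +
      (\<Sum>(j,k)\<in>{..<J}\<times>{..<B}. Polynomial.smult (c (Inr (j, k))) (f j k * H))"
    using c(2) unfolding I_def b_def by (simp add: sum.Plus comp_def case_prod_unfold)
  also have "\<dots> = (\<Sum>j<J. (\<Sum>k<A. Polynomial.smult (c (Inl (j, k))) (f j k)) +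
      (\<Sum>k<B. Polynomial.smult (c (Inr (j, k))) (f j k * H)))"
    by (simp add: sum.cartesian_product sum.distrib)
  also have "\<dots> = (\<Sum>j<J. monom 1 j * (u j ^ P + w j ^ P * H))"
    by (intro sum.cong refl)
      (simp add: u_def w_def power_P f_def sum_distrib_left sum_distrib_right distrib_left
        mult_monom smult_monom flip: mult.assoc mult_smult_left)
  finally have rel: "(\<Sum>j<J. monom 1 j * (u j ^ P + w j ^ P * G ^ ((P + 1) div 2))) = 0"
    by (simp add: H_def J)
  from c(1) obtain j where j: "j < J" "u j \<noteq> 0 \<or> w j \<noteq> 0"
    unfolding I_def using coeffs coeffs' \<rho>0
    by (auto simp: Plus_def) (metis coeff_0)+
  have deg_u: "Polynomial.degree (u j) < A" for j
    unfolding u_def by (rule degree_sum_less) (use AB in \<open>auto intro: le_less_trans[OF degree_monom_le]\<close>)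
  have deg_w: "Polynomial.degree (w j) + d < A" for j
  proof -
    have "Polynomial.degree (w j) < B"
      unfolding w_def by (rule degree_sum_less) (use AB in \<open>auto intro: le_less_trans[OF degree_monom_le]\<close>)
    then show ?thesis by (simp add: AB)
  qed
  show ?thesis using j deg_u deg_w rel by blast
qed

section \<open>A value that is not a nonzero square\<close>

text \<open>The set \<open>S\<close> plays the field with \<open>P * Q\<close> elements, where
  Euler's criterion expresses being a nonzero square as a power equal to 1. If this held on all of
  \<open>S\<close>, the nonzero polynomial \<open>h\<close> would have more roots than its degree
  allows.\<close>

lemma stepanov_value_not_square:
  fixes G :: "'k::alg_closed_field poly"
  assumes char: "Factorial_Ring.prime CHAR('k)" "odd CHAR('k)"
    and P: "P = CHAR('k) ^ n" and Q: "Q = CHAR('k) ^ l"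
    and deg: "Polynomial.degree G = 2 * d" "2 * d < P" "(P + 3) * (d + 1) \<le> Q"
    and G: "odd (Polynomial.order r G)" "poly G 0 \<noteq> 0"
    and S: "card S = P * Q" "\<And>x. x \<in> S \<Longrightarrow> x ^ (P * Q) = x"
  shows "\<exists>x\<in>S. poly G x ^ ((P * Q - 1) div 2) \<noteq> 1"
proof (rule ccontr)
  assume "\<not> (\<exists>x\<in>S. poly G x ^ ((P * Q - 1) div 2) \<noteq> 1)"
  then have one: "\<And>x. x \<in> S \<Longrightarrow> poly G x ^ ((P * Q - 1) div 2) = 1" by blast
  have oddP: "odd P" and oddQ: "odd Q" using char(2) by (simp_all add: P Q)
  define J where "J = (P + 1) div 2"
  define A where "A = (J + 1) * (d + 1)"
  have J2: "2 * J = P + 1" using oddP by (simp add: J_def)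
  obtain j and u w :: "nat \<Rightarrow> 'k poly" where j: "j < J" "u j \<noteq> 0 \<or> w j \<noteq> 0"
    and deg_u: "\<And>j. Polynomial.degree (u j) < A" and deg_w: "\<And>j. Polynomial.degree (w j) + d < A"
    and rel: "(\<Sum>j<J. monom 1 j * (u j ^ P + w j ^ P * G ^ ((P + 1) div 2))) = 0"
    using stepanov_auxiliary[OF char(1) P oddP deg(1) J_def A_def] by blast
  have AQ: "2 * A \<le> Q"
  proof -
    have "2 * A = (2 * J + 2) * (d + 1)" by (simp add: A_def)
    also have "2 * J + 2 = P + 3" using J2 by simp
    finally show ?thesis using deg(3) by simp
  qed
  define h where "h = (\<Sum>j<J. monom 1 (j * Q) * (u j + w j * G ^ ((Q + 1) div 2)))"
  have "h \<noteq> 0"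
  proof
    assume "h = 0"
    moreover have "2 * Polynomial.degree (u i) < Q" for i using deg_u[of i] AQ by linarith
    moreover have "2 * Polynomial.degree (w i) + Polynomial.degree G < Q" for i
      using deg_w[of i] AQ deg(1) by linarith
    ultimately have "u j = 0 \<and> w j = 0"
      unfolding h_def by (intro stepanov_nonvanishing[OF char(1) Q oddQ G _ _ _ j(1)])
    with j(2) show False by simp
  qed
  have "Polynomial.degree h < P * Q"
    unfolding h_def
  proof (rule degree_sum_less)
    show "P * Q > 0" using oddP oddQ by (simp add: odd_pos)
    fix i assume "i \<in> {..<J}"
    then have i: "i + 1 \<le> J" by simp
    have "Polynomial.degree (G ^ ((Q + 1) div 2)) \<le> 2 * d * ((Q + 1) div 2)"
      unfolding deg(1)[symmetric] by (rule degree_power_le)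
    also have "\<dots> = d * Q + d" using oddQ by (auto elim!: oddE simp: algebra_simps)
    finally have "Polynomial.degree (w i * G ^ ((Q + 1) div 2)) < A + d * Q"
      using degree_mult_le[of "w i" "G ^ ((Q + 1) div 2)"] deg_w[of i] by linarith
    then have "Polynomial.degree (u i + w i * G ^ ((Q + 1) div 2)) < A + d * Q"
      using deg_u[of i] by (intro degree_add_less) auto
    then have "Polynomial.degree (monom 1 (i * Q) * (u i + w i * G ^ ((Q + 1) div 2))) < i * Q + (A + d * Q)"
      using degree_mult_le[of "monom 1 (i * Q)" "u i + w i * G ^ ((Q + 1) div 2)"]
        degree_monom_le[of "1::'k" "i * Q"] by linarith
    \<comment> \<open>The bound \<open>A \<le> Q\<close> absorbs \<open>A\<close> into one further
      multiple of \<open>Q\<close>. Then \<open>i + 1 + d \<le> J + d \<le> P\<close>, because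
      \<open>P\<close> is odd and \<open>2 * d < P\<close>.\<close>
    also have "\<dots> \<le> (i + 1 + d) * Q" using AQ by (simp add: algebra_simps)
    also have "\<dots> \<le> P * Q" using i J2 deg(2) oddP by (intro mult_right_mono) presburger+
    finally show "Polynomial.degree (monom 1 (i * Q) * (u i + w i * G ^ ((Q + 1) div 2))) < P * Q" .
  qed
  moreover have "poly h x = 0" if x: "x \<in> S" for x
  proof -
    \<comment> \<open>This splits off the exponent of Euler's criterion: on \<open>S\<close> the
      \<open>P\<close>-th power of \<open>G ^ ((Q + 1) div 2)\<close> becomes
      \<open>G ^ ((P + 1) div 2)\<close>.\<close>
    have exps: "(Q + 1) div 2 * P = (P * Q - 1) div 2 + (P + 1) div 2"
      using oddP oddQ by (auto elim!: oddE simp: algebra_simps)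
    have "poly h x ^ P = (\<Sum>j<J. (x ^ (j * Q) * (poly (u j) x + poly (w j) x * poly G x ^ ((Q + 1) div 2))) ^ P)"
      unfolding h_def poly_sum
      by (subst freshmans_dream_sum'[where n = n]) (use char P in \<open>simp_all add: poly_monom\<close>)
    also have "\<dots> = (\<Sum>j<J. x ^ j * (poly (u j) x ^ P + poly (w j) x ^ P * poly G x ^ ((P + 1) div 2)))"
    proof (rule sum.cong)
      fix i assume "i \<in> {..<J}"
      have "(x ^ (i * Q)) ^ P = (x ^ (P * Q)) ^ i" by (simp add: mult_ac flip: power_mult)
      then have 1: "(x ^ (i * Q)) ^ P = x ^ i" using S(2)[OF x] by simp
      have 2: "(poly G x ^ ((Q + 1) div 2)) ^ P = poly G x ^ ((P + 1) div 2)"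
        unfolding power_mult[symmetric] exps power_add using one[OF x] by simp
      have "(poly (u i) x + poly (w i) x * poly G x ^ ((Q + 1) div 2)) ^ P =
          poly (u i) x ^ P + (poly (w i) x * poly G x ^ ((Q + 1) div 2)) ^ P"
        by (rule freshmans_dream'[OF char(1) P])
      then show "(x ^ (i * Q) * (poly (u i) x + poly (w i) x * poly G x ^ ((Q + 1) div 2))) ^ P =
          x ^ i * (poly (u i) x ^ P + poly (w i) x ^ P * poly G x ^ ((P + 1) div 2))"
        unfolding power_mult_distrib 1 2 by simp
    qed simp
    also have "\<dots> = poly (\<Sum>j<J. monom 1 j * (u j ^ P + w j ^ P * G ^ ((P + 1) div 2))) x"
      by (simp add: poly_sum poly_monom)
    also have "\<dots> = 0" by (simp only: rel poly_0)
    finally show ?thesis by simp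
  qed
  then have "S \<subseteq> {x. poly h x = 0}" by blast
  then have "card S \<le> card {x. poly h x = 0}"
    using poly_roots_finite[OF \<open>h \<noteq> 0\<close>] by (rule card_mono[rotated])
  ultimately show False using card_poly_roots_bound[OF \<open>h \<noteq> 0\<close>] S(1) by linarith
qed

section \<open>The polynomial \<open>G\<close> and its simple roots\<close>

lemma order_eq_1_if_simple_root:
  fixes G :: "'k::field poly"
  assumes "poly G r = 0" "poly (pderiv G) r \<noteq> 0"
  shows "Polynomial.order r G = 1"
proof -
  have G: "G \<noteq> 0" using assms(2) by auto
  then have "Polynomial.order r G \<noteq> 0" using assms(1) order_root by blast
  moreover have "\<not> 2 \<le> Polynomial.order r G"
  proof
    assume "2 \<le> Polynomial.order r G"
    then have "[:-r, 1:] ^ 2 dvd G" using G by (simp add: order_divides)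
    then obtain H where "G = [:-r, 1:] ^ 2 * H" by (elim dvdE)
    then have "G = [:-r, 1:] * ([:-r, 1:] * H)" by (simp only: power2_eq_square mult.assoc)
    then have "poly (pderiv G) r = 0" by (simp only: pderiv_mult) simp
    with assms(2) show False by simp
  qed
  ultimately show ?thesis by linarith
qed

text \<open>The polynomial \<open>G\<close> of the introduction.\<close>

definition discr_poly :: "nat \<Rightarrow> 'k::field poly" where
  "discr_poly p = monom 1 (3 * p - 1) - monom 4 (p - 1) + [:4:]"

lemma poly_discr_poly: "poly (discr_poly p) x = x ^ (3 * p - 1) - 4 * x ^ (p - 1) + 4"
  by (simp add: discr_poly_def poly_monom)

lemma degree_discr_poly:
  assumes "p > 0"
  shows "Polynomial.degree (discr_poly p :: 'k::field poly) = 3 * p - 1"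
proof -
  have "Polynomial.degree ([:4:] - monom 4 (p - 1) :: 'k poly) < 3 * p - 1"
    by (rule degree_diff_less) (use assms in \<open>auto intro: le_less_trans[OF degree_monom_le]\<close>)
  then have "Polynomial.degree (monom 1 (3 * p - 1) + ([:4:] - monom 4 (p - 1)) :: 'k poly) = 3 * p - 1"
    by (subst degree_add_eq_left) (simp_all add: degree_monom_eq)
  then show ?thesis by (simp add: discr_poly_def algebra_simps)
qed

lemma small_numerals_nonzero:
  assumes "CHAR('k::field) \<ge> 5"
  shows "(2::'k) \<noteq> 0" "(3::'k) \<noteq> 0" "(4::'k) \<noteq> 0"
proof -
  have "(of_nat n :: 'k) \<noteq> 0" if "0 < n" "n < 5" for n
    using that assms by (auto simp: of_nat_eq_0_iff_char_dvd dest: dvd_imp_le)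
  from this[of 2] this[of 3] this[of 4] show "(2::'k) \<noteq> 0" "(3::'k) \<noteq> 0" "(4::'k) \<noteq> 0" by simp_all
qed

text \<open>Both exponents \<open>3 * p - 1\<close> and \<open>p - 1\<close> are -1 in
  characteristic \<open>p\<close>, so \<open>T G' = 4 - G\<close>. At a root \<open>r\<close> of
  \<open>G\<close> this gives \<open>r G'(r) = 4\<close>, which is nonzero; hence every root is
  simple.\<close>

lemma discr_poly_simple_root:
  assumes "CHAR('k::alg_closed_field) = p" "p \<ge> 5"
  shows "\<exists>r. Polynomial.order r (discr_poly p :: 'k poly) = 1"
proof -
  have "Polynomial.degree (discr_poly p :: 'k poly) > 0"
    using assms(2) by (subst degree_discr_poly) simp_all
  then obtain r :: 'k where r: "poly (discr_poly p) r = 0"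
    using alg_closed_imp_poly_has_root by blast
  have p0: "of_nat p = (0::'k)" using assms(1) of_nat_CHAR by metis
  have "3 * p - 1 = Suc (3 * p - 2)" "p - 1 = Suc (p - 2)" using assms(2) by simp_all
  then have pw: "r ^ (3 * p - 1) = r * r ^ (3 * p - 2)" "r ^ (p - 1) = r * r ^ (p - 2)"
    by (simp_all only: power_Suc)
  have c: "of_nat (3 * p - 1) = (-1 :: 'k)" "of_nat (p - 1) = (-1 :: 'k)"
    using assms(2) p0 by (simp_all add: of_nat_diff)
  have "pderiv (discr_poly p :: 'k poly) = monom (-1) (3 * p - 2) - monom (-4) (p - 2)"
    unfolding discr_poly_def pderiv_add pderiv_diff pderiv_monom c
    by (simp add: pderiv_pCons numeral_2_eq_2)
  then have "poly (pderiv (discr_poly p)) r = 4 * r ^ (p - 2) - r ^ (3 * p - 2)"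
    by (simp add: poly_monom)
  moreover have "r * (4 * r ^ (p - 2) - r ^ (3 * p - 2)) = 4"
    using r unfolding poly_discr_poly pw by (simp add: algebra_simps)
  ultimately have "poly (pderiv (discr_poly p)) r \<noteq> 0"
    using small_numerals_nonzero[where 'k='k] assms by auto
  with r show ?thesis using order_eq_1_if_simple_root by blast
qed

section \<open>Collisions of \<open>c_p\<close> from values of \<open>G\<close>\<close>

text \<open>The linear terms differ by \<open>2 d = e ^ p\<close>, so it suffices that
  \<open>T^3 - T\<close> takes values differing by \<open>-e\<close> at \<open>u + d\<close> and
  \<open>u - d\<close>. That difference is \<open>2 d (3 u^2 + d^2 - 1)\<close>, so the condition
  reads \<open>E (3 u^2 + d^2 - 1) = -1\<close> with \<open>E = e ^ (p - 1)\<close>. Multiplying by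
  4 and inserting \<open>w^2 = 4 E u^2\<close> turns it into the assumption on
  \<open>w\<close>.\<close>

lemma cubic_frobenius_collision:
  fixes e w :: "'k::field"
  assumes p: "Factorial_Ring.prime p" "CHAR('k) = p" "p \<ge> 5" and "e \<noteq> 0"
    and w: "- 3 * w\<^sup>2 = poly (discr_poly p) e"
  defines "u \<equiv> w / (2 * e ^ ((p - 1) div 2))" and "d \<equiv> e ^ p / 2"
  shows "u + d \<noteq> u - d"
    and "(u + d) + ((u + d) ^ 3 - (u + d)) ^ p = (u - d) + ((u - d) ^ 3 - (u - d)) ^ p"
proof -
  note nz = small_numerals_nonzero[where 'k='k]
  have 2: "(2::'k) \<noteq> 0" and 4: "(4::'k) \<noteq> 0" using nz p by auto
  have dd: "d + d = e ^ p" unfolding d_def using 2 by (simp flip: mult_2)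
  show "u + d \<noteq> u - d"
    using dd \<open>e \<noteq> 0\<close> by (auto simp: algebra_simps eq_neg_iff_add_eq_0)
  have "odd p" using p by (simp add: prime_odd_nat)
  define E where "E = e ^ (p - 1)"
  have E0: "E \<noteq> 0" using \<open>e \<noteq> 0\<close> by (simp add: E_def)
  have E2: "(e ^ ((p - 1) div 2))\<^sup>2 = E"
    using \<open>odd p\<close> by (auto simp: E_def elim!: oddE simp flip: power_mult)
  have ep: "e ^ p = e * E" using p by (simp add: E_def flip: power_Suc)
  have "3 * p - 1 = p + p + (p - 1)" using p by linarith
  then have "e ^ (3 * p - 1) = (e ^ p)\<^sup>2 * E"
    by (simp only: power_add power2_eq_square E_def)
  then have Ge: "- 3 * w\<^sup>2 = (e * E)\<^sup>2 * E - 4 * E + 4"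
    using w by (simp only: poly_discr_poly E_def ep)
  have u2: "u\<^sup>2 = w\<^sup>2 / (4 * E)"
    unfolding u_def power_divide power_mult_distrib E2 by simp
  have d2: "d\<^sup>2 = (e * E)\<^sup>2 / 4" by (simp add: d_def power_divide ep)
  have u2': "4 * E * u\<^sup>2 = w\<^sup>2" using 4 E0 by (simp add: u2)
  have d2': "4 * d\<^sup>2 = (e * E)\<^sup>2" using 4 by (simp add: d2)
  have "E * (4 * (3 * u\<^sup>2 + d\<^sup>2 - 1)) = 3 * (4 * E * u\<^sup>2) + E * (4 * d\<^sup>2) - 4 * E"
    by (simp add: algebra_simps)
  also have "\<dots> = - 4" unfolding u2' d2' using Ge by (simp add: algebra_simps)
  finally have "E * (4 * (3 * u\<^sup>2 + d\<^sup>2 - 1)) = - 4" .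
  then have "4 * (E * (3 * u\<^sup>2 + d\<^sup>2 - 1) + 1) = 0"
    by (simp only: distrib_left mult.left_commute) simp
  then have "E * (3 * u\<^sup>2 + d\<^sup>2 - 1) + 1 = 0" using 4 by (simp only: mult_eq_0_iff) simp
  then have k: "E * (3 * u\<^sup>2 + d\<^sup>2 - 1) = - 1" by (rule eq_neg_iff_add_eq_0[THEN iffD2])
  have ring: "((a + b) ^ 3 - (a + b)) - ((a - b) ^ 3 - (a - b)) = (b + b) * (3 * a\<^sup>2 + b\<^sup>2 - 1)"
    for a b :: 'k by (simp add: power3_eq_cube power2_eq_square algebra_simps)
  have "((u + d) ^ 3 - (u + d)) - ((u - d) ^ 3 - (u - d)) = (d + d) * (3 * u\<^sup>2 + d\<^sup>2 - 1)"
    by (rule ring)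
  also have "\<dots> = e * (E * (3 * u\<^sup>2 + d\<^sup>2 - 1))" unfolding dd ep by (simp only: mult.assoc)
  also have "\<dots> = - e" unfolding k by simp
  finally have "(u + d) ^ 3 - (u + d) = ((u - d) ^ 3 - (u - d)) + (- e)"
    unfolding diff_eq_eq by (simp only: add.commute)
  then have "((u + d) ^ 3 - (u + d)) ^ p = (((u - d) ^ 3 - (u - d)) + (- e)) ^ p" by (rule arg_cong)
  also have "\<dots> = ((u - d) ^ 3 - (u - d)) ^ p + (- e) ^ p"
    by (rule freshmans_dream) (simp_all only: p)
  also have "(- e) ^ p = - (d + d)" unfolding dd using \<open>odd p\<close> by (rule power_minus_odd)
  finally have eq: "((u + d) ^ 3 - (u + d)) ^ p = ((u - d) ^ 3 - (u - d)) ^ p + - (d + d)" .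
  show "(u + d) + ((u + d) ^ 3 - (u + d)) ^ p = (u - d) + ((u - d) ^ 3 - (u - d)) ^ p"
    unfolding eq by simp
qed

lemma finite_ext_power: "x \<in> finite_ext m \<Longrightarrow> x ^ k \<in> finite_ext m"
  by (induction k) (auto intro: finite_ext_one finite_ext_mult)

text \<open>Let \<open>s\<close> be a square root of -3 in the algebraic closure. Since its square
  is fixed by the \<open>q\<close>-th power map, \<open>s\<close> is either fixed or negated, and
  the two cases decide whether -3 is a square in the field with \<open>q\<close> elements.\<close>

lemma discr_poly_value_exists:
  fixes m :: nat
  assumes p: "Factorial_Ring.prime CARD('a::finite_field)" "CARD('a) \<ge> 5" and m: "m \<ge> 6"
  shows "\<exists>e\<in>finite_ext m. \<exists>w\<in>finite_ext m. e \<noteq> 0 \<and>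
    - 3 * w\<^sup>2 = poly (discr_poly CARD('a)) (e :: 'a alg_closure)"
proof -
  define p where "p = CARD('a)"
  define q where "q = p ^ m"
  have prime: "Factorial_Ring.prime p" and p5: "p \<ge> 5" using p by (simp_all add: p_def)
  have char: "CHAR('a alg_closure) = p"
    using CHAR_eq_CARD_prime[OF p(1)] by (simp add: p_def)
  have nz: "(2::'a alg_closure) \<noteq> 0" "(3::'a alg_closure) \<noteq> 0"
    using small_numerals_nonzero[where 'k="'a alg_closure"] char p5 by auto
  have "odd p" using prime p5 by (simp add: prime_odd_nat)
  then have "odd q" by (simp add: q_def)
  then have q_Suc: "q = Suc (2 * ((q - 1) div 2))" by presburger
  have F: "x \<in> finite_ext m \<longleftrightarrow> x ^ q = x" for x :: "'a alg_closure"
    by (simp add: finite_ext_def q_def p_def)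
  have numF: "numeral k ^ q = (numeral k :: 'a alg_closure)" for k
    using to_ac_in_finite_ext[of "numeral k :: 'a" m] unfolding F by simp
  have root_cases: "x ^ q = x \<or> x ^ q = - x" if "x\<^sup>2 ^ q = x\<^sup>2" for x :: "'a alg_closure"
  proof -
    have "(x ^ q)\<^sup>2 = x\<^sup>2" using that by (metis power_mult mult.commute)
    then show ?thesis by (simp add: power2_eq_iff)
  qed
  obtain s :: "'a alg_closure" where s: "s\<^sup>2 = - 3"
    using nth_root_exists[of 2 "- 3 :: 'a alg_closure"] by auto
  then have "s \<noteq> 0" using nz by auto
  have "s\<^sup>2 ^ q = s\<^sup>2" unfolding s using \<open>odd q\<close> by (simp add: numF)
  then consider "s ^ q = s" | "s ^ q = - s" using root_cases by blast
  then have "\<exists>e\<in>finite_ext m. \<exists>w\<in>finite_ext m. e \<noteq> 0 \<and>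
    - 3 * w\<^sup>2 = poly (discr_poly p) (e :: 'a alg_closure)"
  proof cases
    \<comment> \<open>Here \<open>e = 1\<close> and \<open>w = 1 / s\<close> work, as
      \<open>G(1) = 1\<close>.\<close>
    case 1
    then have "inverse s \<in> finite_ext m" by (simp add: F power_inverse)
    moreover have "- 3 * (inverse s)\<^sup>2 = poly (discr_poly p) 1"
      unfolding s[symmetric] using \<open>s \<noteq> 0\<close>
      by (simp add: poly_discr_poly flip: power_mult_distrib)
    ultimately show ?thesis using finite_ext_one zero_neq_one by metis
  next
    case 2
    \<comment> \<open>With \<open>P = p^2\<close> and \<open>Q = p ^ l\<close>, the condition
      \<open>m \<ge> 6\<close> gives \<open>Q \<ge> p^4\<close>, which dominates
      \<open>(p^2 + 3) * (d + 1)\<close> for \<open>p \<ge> 5\<close>.\<close>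
    define l where "l = m - 2"
    have l: "m = 2 + l" "l \<ge> 4" using m by (simp_all add: l_def)
    have q: "q = p ^ 2 * p ^ l" unfolding q_def l(1) by (rule power_add)
    define d where "d = (3 * p - 1) div 2"
    have d: "3 * p - 1 = 2 * d" using \<open>odd p\<close> by (auto simp: d_def elim!: oddE)
    have "5 * p \<le> p\<^sup>2" using p5 by (simp add: power2_eq_square)
    then have dp: "2 * d < p\<^sup>2" using d p5 by linarith
    have "(p\<^sup>2 + 3) * (d + 1) \<le> (2 * p\<^sup>2) * (2 * p)"
      by (rule mult_mono) (use d p5 \<open>5 * p \<le> p\<^sup>2\<close> in linarith)+
    also have "\<dots> = 4 * p ^ 3" by (simp add: power2_eq_square power3_eq_cube)
    also have "\<dots> \<le> p * p ^ 3" using p5 by (intro mult_right_mono) auto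
    also have "\<dots> = p ^ 4" by (simp flip: power_Suc)
    also have "\<dots> \<le> p ^ l" using l p5 by (intro power_increasing) auto
    finally have big: "(p\<^sup>2 + 3) * (d + 1) \<le> p ^ l" .
    obtain r :: "'a alg_closure" where r: "Polynomial.order r (discr_poly p) = 1"
      using discr_poly_simple_root[OF char p5] by blast
    have "\<exists>e\<in>finite_ext m. poly (discr_poly p) (e :: 'a alg_closure) ^ ((p\<^sup>2 * p ^ l - 1) div 2) \<noteq> 1"
    proof (rule stepanov_value_not_square[where n = 2 and l = l and d = d and r = r])
      show "Polynomial.degree (discr_poly p :: 'a alg_closure poly) = 2 * d"
        using p5 d by (subst degree_discr_poly) auto
      show "poly (discr_poly p) 0 \<noteq> (0 :: 'a alg_closure)"
        using p5 small_numerals_nonzero[where 'k="'a alg_closure"] char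
        by (simp add: poly_discr_poly power_0_left)
      show "card (finite_ext m :: 'a alg_closure set) = p\<^sup>2 * p ^ l"
        unfolding q[symmetric] unfolding q_def p_def using m by (intro card_finite_ext p(1)) simp
    qed (use prime char \<open>odd p\<close> dp big r F in \<open>simp_all add: q\<close>)
    then obtain e :: "'a alg_closure" where e: "e \<in> finite_ext m"
      "poly (discr_poly p) e ^ ((q - 1) div 2) \<noteq> 1" unfolding q by blast
    have "e \<noteq> 0"
    proof
      assume "e = 0"
      then have "poly (discr_poly p) e = 2\<^sup>2"
        using p5 by (simp add: poly_discr_poly power_0_left)
      then have "poly (discr_poly p) e ^ ((q - 1) div 2) * 2 = 2 ^ q"
        by (subst q_Suc) (simp only: power_Suc2 power_mult)
      with e(2) nz show False by (simp add: numF)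
    qed
    \<comment> \<open>The root \<open>t\<close> is negated by the \<open>q\<close>-th power map,
      also when \<open>t = 0\<close>. As \<open>s\<close> is negated too, the quotient
      \<open>t / s\<close> is fixed and serves as \<open>w\<close>.\<close>
    obtain t where t: "t\<^sup>2 = poly (discr_poly p) e"
      using nth_root_exists[of 2 "poly (discr_poly p) e"] by auto
    have tq: "t ^ q = poly (discr_poly p) e ^ ((q - 1) div 2) * t"
      unfolding t[symmetric] by (subst q_Suc) (simp only: power_Suc2 power_mult)
    have "poly (discr_poly p) e ^ q = poly (discr_poly p) e"
    proof -
      have "poly (discr_poly p) e \<in> finite_ext m"
        unfolding poly_discr_poly diff_conv_add_uminus
        by (intro finite_ext_add finite_ext_minus finite_ext_mult finite_ext_power p(1) e(1))
          (simp_all add: F numF)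
      then show ?thesis by (simp add: F)
    qed
    then have "t ^ q = t \<or> t ^ q = - t" by (intro root_cases) (simp add: t)
    then have "t ^ q = - t" using tq e(2) by (cases "t = 0") auto
    then have "t / s \<in> finite_ext m" using 2 by (simp add: F power_divide)
    moreover have "- 3 * (t / s)\<^sup>2 = poly (discr_poly p) e"
      unfolding t[symmetric] s[symmetric] using \<open>s \<noteq> 0\<close> by (simp add: power_divide)
    ultimately show ?thesis using e(1) \<open>e \<noteq> 0\<close> by blast
  qed
  then show ?thesis by (simp add: p_def)
qed

section \<open>Failure of injectivity over large extensions\<close>

lemma poly_c_poly: "poly (c_poly p) x = x + (x ^ 3 - x) ^ p"
  by (simp add: c_poly_def)

lemma map_poly_to_ac_add: "map_poly to_ac (f + g) = map_poly to_ac f + map_poly to_ac g"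
  by (rule poly_eqI) (simp add: coeff_map_poly)

lemma map_poly_to_ac_diff: "map_poly to_ac (f - g) = map_poly to_ac f - map_poly to_ac g"
  by (rule poly_eqI) (simp add: coeff_map_poly)

lemma map_poly_to_ac_mult: "map_poly to_ac (f * g) = map_poly to_ac f * map_poly to_ac g"
  by (rule poly_eqI) (simp add: coeff_map_poly coeff_mult to_ac_sum)

lemma map_poly_to_ac_power: "map_poly to_ac (f ^ n) = map_poly to_ac f ^ n"
  by (induction n) (simp_all add: map_poly_to_ac_mult)

lemma poly_map_poly_c_poly:
  "poly (map_poly to_ac (c_poly p :: 'a::field poly)) x = x + (x ^ 3 - x) ^ p"
proof -
  have "map_poly to_ac (c_poly p :: 'a poly) = c_poly p"
    by (simp add: c_poly_def map_poly_to_ac_add map_poly_to_ac_diff map_poly_to_ac_power map_poly_pCons)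
  then show ?thesis by (simp add: poly_c_poly)
qed

text \<open>The colliding arguments \<open>u + d\<close> and \<open>u - d\<close> arise from
  \<open>e\<close>, \<open>w\<close> and 2 by field operations, so they stay inside the
  extension.\<close>

lemma c_poly_not_bij_betw_finite_ext:
  fixes m :: nat
  assumes p: "Factorial_Ring.prime CARD('a::finite_field)" "CARD('a) \<ge> 5" and m: "m \<ge> 6"
  shows "\<not> bij_betw (poly (map_poly to_ac (c_poly CARD('a) :: 'a poly))) (finite_ext m) (finite_ext m)"
proof
  define p where "p = CARD('a)"
  have char: "CHAR('a alg_closure) = p" using CHAR_eq_CARD_prime[OF p(1)] by (simp add: p_def)
  assume "bij_betw (poly (map_poly to_ac (c_poly CARD('a) :: 'a poly))) (finite_ext m) (finite_ext m)"
  then have inj: "inj_on (\<lambda>x::'a alg_closure. x + (x ^ 3 - x) ^ p) (finite_ext m)"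
    by (simp add: bij_betw_def inj_on_def poly_map_poly_c_poly p_def)
  obtain e w :: "'a alg_closure" where ew: "e \<in> finite_ext m" "w \<in> finite_ext m" "e \<noteq> 0"
    "- 3 * w\<^sup>2 = poly (discr_poly p) e"
    using discr_poly_value_exists[OF p m] unfolding p_def by blast
  define u where "u = w / (2 * e ^ ((p - 1) div 2))"
  define d where "d = e ^ p / 2"
  have two: "(2 :: 'a alg_closure) \<in> finite_ext m" using to_ac_in_finite_ext[of "2 :: 'a" m] by simp
  have "u \<in> finite_ext m" "d \<in> finite_ext m"
    unfolding u_def d_def divide_inverse
    by (intro finite_ext_mult finite_ext_inverse finite_ext_power ew two)+
  then have "u + d \<in> finite_ext m" "u - d \<in> finite_ext m"
    using finite_ext_add[OF p(1), of u m d] finite_ext_add[OF p(1), of u m "- d"]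
      finite_ext_minus[OF p(1), of d m] by simp_all
  moreover have "u + d \<noteq> u - d"
    "(u + d) + ((u + d) ^ 3 - (u + d)) ^ p = (u - d) + ((u - d) ^ 3 - (u - d)) ^ p"
    unfolding u_def d_def
    by (rule cubic_frobenius_collision; (use p char ew in \<open>simp add: p_def\<close>))+
  ultimately show False using inj unfolding inj_on_def by blast
qed

section \<open>Derivative and behaviour on the prime field\<close>

lemma pderiv_c_poly:
  assumes "of_nat p = (0 :: 'k::idom)"
  shows "pderiv (c_poly p :: 'k poly) = [:1:]"
proof -
  have "Polynomial.smult (of_nat p) f = 0" for f :: "'k poly" using assms by simp
  then show ?thesis by (simp add: c_poly_def pderiv_add pderiv_power pderiv_pCons one_pCons assms)
qed

text \<open>For \<open>p = 3 k + 2\<close>, cubing is inverted by the power \<open>2 k + 1\<close>,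
  because \<open>3 (2 k + 1) = 2 p - 1\<close>. For \<open>p = 3 k + 1\<close> there is a nontrivial
  cube root of unity. The case \<open>p = 3\<close> is set apart because cubing is then the
  identity.\<close>

lemma bij_cube_iff:
  assumes "Factorial_Ring.prime p" "p \<noteq> 3" and card: "CARD('a::finite_field) = p"
  shows "bij (\<lambda>x::'a. x ^ 3) \<longleftrightarrow> [p = 2] (mod 3)"
proof -
  have fermat: "x ^ p = x" for x :: 'a using finite_field_power_card_eq_same[of x] card by simp
  have "\<not> 3 dvd p" using assms(1,2) primes_dvd_imp_eq[of 3 p] by auto
  then consider (one) "p mod 3 = 1" | (two) "p mod 3 = 2" by (auto simp: dvd_eq_mod_eq_0) linarith
  then show ?thesis
  proof cases
    case two
    define k where "k = p div 3"
    have k: "p = 3 * k + 2" using two by (simp add: k_def) presburger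
    have "(x ^ 3) ^ (2 * k + 1) = x" for x :: 'a
    proof -
      have e: "3 * (2 * k + 1) + 1 = p + p" "p = Suc (3 * k + 1)" using k by simp_all
      have "x * (x ^ 3) ^ (2 * k + 1) = x ^ p * x ^ p"
        unfolding power_mult[symmetric] power_Suc[symmetric] power_add[symmetric] e(1)[symmetric] by simp
      then have "x * (x ^ 3) ^ (2 * k + 1) = x * x" by (simp only: fermat)
      then show ?thesis by (cases "x = 0") auto
    qed
    then have "inj (\<lambda>x::'a. x ^ 3)" by (metis injI)
    then have "bij (\<lambda>x::'a. x ^ 3)" by (simp add: bij_def finite_UNIV_inj_surj)
    with two show ?thesis by (simp add: cong_def)
  next
    case one
    define k where "k = p div 3"
    have k: "p = 3 * k + 1" using one by (simp add: k_def) presburger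
    have "k > 0" using prime_gt_1_nat[OF assms(1)] k by simp
    \<comment> \<open>The roots of \<open>T ^ (k + 1) - T\<close> are 0 and the elements with
      \<open>x ^ k = 1\<close>. There are at most \<open>k + 1 < p\<close> of them, so some nonzero
      \<open>x\<close> has \<open>x ^ k \<noteq> 1\<close>, and \<open>x ^ k\<close> is a nontrivial
      cube root of unity.\<close>
    define h :: "'a poly" where "h = monom 1 (Suc k) - monom 1 1"
    have "poly.coeff h (Suc k) = 1" using \<open>k > 0\<close> by (simp add: h_def)
    then have "h \<noteq> 0" by auto
    have "Polynomial.degree h \<le> Suc k"
      unfolding h_def by (rule degree_diff_le) (use \<open>k > 0\<close> in \<open>auto intro: order_trans[OF degree_monom_le]\<close>)
    then have "card {x. poly h x = 0} < CARD('a)"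
      using card_poly_roots_bound[OF \<open>h \<noteq> 0\<close>] card k \<open>k > 0\<close> by linarith
    then have "{x. poly h x = 0} \<noteq> UNIV" by auto
    then obtain x where "poly h x \<noteq> 0" by auto
    then have x: "x \<noteq> 0" "x ^ k \<noteq> 1" by (auto simp: h_def poly_monom)
    have "x * (x ^ k) ^ 3 = x ^ p" by (simp add: k mult.commute flip: power_mult)
    with x fermat have "(x ^ k) ^ 3 = 1 ^ 3" by simp
    with x have "\<not> inj (\<lambda>x::'a. x ^ 3)" by (metis injD)
    with one show ?thesis by (simp add: bij_def cong_def)
  qed
qed

theorem proposition7p4:
  fixes p :: nat
  assumes "Factorial_Ring.prime p" and "p \<ge> 5" and "CARD('a::finite_field) = p"
  shows "\<not> exceptional (c_poly p :: 'a poly) \<and>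
    (\<forall>x::'a. poly (c_poly p) x = x ^ 3) \<and>
    (mock_automorphism (c_poly p :: 'a poly) \<longleftrightarrow> [p = 2] (mod 3))"
proof (intro conjI)
  \<comment> \<open>Collisions exist for every \<open>m \<ge> 6\<close>, so only finitely many
    degrees can admit a bijection.\<close>
  have "{m. m \<ge> 1 \<and> bij_betw (poly (map_poly to_ac (c_poly p :: 'a poly))) (finite_ext m) (finite_ext m)} \<subseteq> {..<6}"
    using c_poly_not_bij_betw_finite_ext[where 'a = 'a] assms by (auto simp: not_less[symmetric])
  then show "\<not> exceptional (c_poly p :: 'a poly)"
    unfolding exceptional_def by (metis finite_lessThan finite_subset)
  have fermat: "x ^ p = x" for x :: 'a
    using finite_field_power_card_eq_same[of x] assms(3) by simp
  show cube: "\<forall>x::'a. poly (c_poly p) x = x ^ 3"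
    by (simp add: poly_c_poly fermat)
  have "of_nat p = (0::'a)"
    using CHAR_eq_CARD_prime[where 'a = 'a] assms by (metis of_nat_CHAR)
  then have "mock_automorphism (c_poly p :: 'a poly) \<longleftrightarrow> bij (poly (c_poly p :: 'a poly))"
    unfolding mock_automorphism_def by (auto simp: pderiv_c_poly)
  also have "poly (c_poly p :: 'a poly) = (\<lambda>x. x ^ 3)" using cube by blast
  also have "bij (\<lambda>x::'a. x ^ 3) \<longleftrightarrow> [p = 2] (mod 3)" using assms by (intro bij_cube_iff) auto
  finally show "mock_automorphism (c_poly p :: 'a poly) \<longleftrightarrow> [p = 2] (mod 3)" .
qed

end
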